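(* Every closed symmetric monoidal category $\mathcal{C}$ admits a lax $\mathrm{O}(1)$-volutive structure.
   Context: A symmetric monoidal category $\mathcal{C}$ is closed if for every object $a$ the functor $(-)\otimes a\colon \mathcal{C}\to\mathcal{C}$ admits a right adjoint $b\mapsto b^a$. A lax $\mathrm{O}(1)$-volutive structure on a category $\mathcal{C}$ consists of a functor $d\colon\mathcal{C}\to\mathcal{C}^{\mathrm{op}}$ and a natural transformation $\eta\colon \mathrm{id}_{\mathcal{C}}\to d^{\mathrm{op}}\circ d$ (with components $\eta_a\colon a\to d(d(a))$, not required to be invertible) satisfying $d(\eta_a)\circ\eta_{d(a)}=\mathrm{id}_{d(a)}$ for all $a\in\mathcal{C}$. *)

theory Defs
  imports Main
begin

section \<open>Categories, functors and natural transformations\<close>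

record ('o, 'm) category =
  Obj :: "'o set"
  Arr :: "'m set"
  Dom :: "'m \<Rightarrow> 'o"
  Cod :: "'m \<Rightarrow> 'o"
  Ident :: "'o \<Rightarrow> 'm"
  Comp :: "'m \<Rightarrow> 'm \<Rightarrow> 'm" (infixr "\<cdot>\<index>" 55)

definition hom :: "('o, 'm, 'x) category_scheme \<Rightarrow> 'o \<Rightarrow> 'o \<Rightarrow> 'm set" where
  "hom C a b = {f \<in> Arr C. Dom C f = a \<and> Cod C f = b}"

locale category =
  fixes C :: "('o, 'm, 'x) category_scheme" (structure)
  assumes Dom_in_Obj: "f \<in> Arr C \<Longrightarrow> Dom C f \<in> Obj C"
    and Cod_in_Obj: "f \<in> Arr C \<Longrightarrow> Cod C f \<in> Obj C"
    and Ident_in_hom: "a \<in> Obj C \<Longrightarrow> Ident C a \<in> hom C a a"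
    and Comp_in_hom: "\<lbrakk>f \<in> hom C a b; g \<in> hom C b c\<rbrakk> \<Longrightarrow> g \<cdot> f \<in> hom C a c"
    and Comp_Ident: "f \<in> hom C a b \<Longrightarrow> f \<cdot> Ident C a = f"
    and Ident_Comp: "f \<in> hom C a b \<Longrightarrow> Ident C b \<cdot> f = f"
    and Comp_assoc:
      "\<lbrakk>f \<in> hom C a b; g \<in> hom C b c; h \<in> hom C c d\<rbrakk> \<Longrightarrow> (h \<cdot> g) \<cdot> f = h \<cdot> (g \<cdot> f)"

definition is_iso :: "('o, 'm, 'x) category_scheme \<Rightarrow> 'm \<Rightarrow> bool" where
  "is_iso C f \<longleftrightarrow> f \<in> Arr C \<and>
     (\<exists>g \<in> hom C (Cod C f) (Dom C f).
        g \<cdot>\<^bsub>C\<^esub> f = Ident C (Dom C f) \<and> f \<cdot>\<^bsub>C\<^esub> g = Ident C (Cod C f))"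

definition op_cat :: "('o, 'm, 'x) category_scheme \<Rightarrow> ('o, 'm) category" where
  "op_cat C = \<lparr>Obj = Obj C, Arr = Arr C, Dom = Cod C, Cod = Dom C,
     Ident = Ident C, Comp = (\<lambda>g f. f \<cdot>\<^bsub>C\<^esub> g)\<rparr>"

definition prod_cat ::
  "('o, 'm, 'x) category_scheme \<Rightarrow> ('p, 'n, 'y) category_scheme \<Rightarrow> ('o \<times> 'p, 'm \<times> 'n) category"
where
  "prod_cat C D = \<lparr>Obj = Obj C \<times> Obj D, Arr = Arr C \<times> Arr D,
     Dom = map_prod (Dom C) (Dom D), Cod = map_prod (Cod C) (Cod D),
     Ident = map_prod (Ident C) (Ident D),
     Comp = (\<lambda>(g, g') (f, f'). (g \<cdot>\<^bsub>C\<^esub> f, g' \<cdot>\<^bsub>D\<^esub> f'))\<rparr>"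

record ('o, 'm, 'p, 'n) cat_functor =
  FObj :: "'o \<Rightarrow> 'p"
  FArr :: "'m \<Rightarrow> 'n"

locale is_functor = C: category C + D: category D
  for C :: "('o, 'm, 'x) category_scheme" and D :: "('p, 'n, 'y) category_scheme" +
  fixes F :: "('o, 'm, 'p, 'n) cat_functor"
  assumes FObj_in_Obj: "a \<in> Obj C \<Longrightarrow> FObj F a \<in> Obj D"
    and FArr_in_hom: "f \<in> hom C a b \<Longrightarrow> FArr F f \<in> hom D (FObj F a) (FObj F b)"
    and FArr_Ident: "a \<in> Obj C \<Longrightarrow> FArr F (Ident C a) = Ident D (FObj F a)"
    and FArr_Comp:
      "\<lbrakk>f \<in> hom C a b; g \<in> hom C b c\<rbrakk> \<Longrightarrow> FArr F (g \<cdot>\<^bsub>C\<^esub> f) = FArr F g \<cdot>\<^bsub>D\<^esub> FArr F f"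

definition id_functor :: "('o, 'm, 'o, 'm) cat_functor" where
  "id_functor = \<lparr>FObj = (\<lambda>a. a), FArr = (\<lambda>f. f)\<rparr>"

definition comp_functor ::
  "('p, 'n, 'q, 'k) cat_functor \<Rightarrow> ('o, 'm, 'p, 'n) cat_functor \<Rightarrow> ('o, 'm, 'q, 'k) cat_functor"
  (infixr "\<circ>\<^sub>F" 55)
where
  "G \<circ>\<^sub>F F = \<lparr>FObj = (\<lambda>a. FObj G (FObj F a)), FArr = (\<lambda>f. FArr G (FArr F f))\<rparr>"

text \<open>
  A functor \<open>C \<rightarrow> D\<close> and its opposite \<open>op_cat C \<rightarrow> op_cat D\<close> have the same object and arrow maps;
  source and target are not part of the record.
\<close>

definition op_functor :: "('o, 'm, 'p, 'n) cat_functor \<Rightarrow> ('o, 'm, 'p, 'n) cat_functor" where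
  "op_functor F = \<lparr>FObj = FObj F, FArr = FArr F\<rparr>"

locale natural_transformation = F: is_functor C D F + G: is_functor C D G
  for C :: "('o, 'm, 'x) category_scheme" and D :: "('p, 'n, 'y) category_scheme"
    and F G :: "('o, 'm, 'p, 'n) cat_functor" +
  fixes \<tau> :: "'o \<Rightarrow> 'n"
  assumes component_in_hom: "a \<in> Obj C \<Longrightarrow> \<tau> a \<in> hom D (FObj F a) (FObj G a)"
    and naturality: "f \<in> hom C a b \<Longrightarrow> \<tau> b \<cdot>\<^bsub>D\<^esub> FArr F f = FArr G f \<cdot>\<^bsub>D\<^esub> \<tau> a"

locale natural_isomorphism = natural_transformation C D F G \<tau>
  for C :: "('o, 'm, 'x) category_scheme" and D :: "('p, 'n, 'y) category_scheme"
    and F G :: "('o, 'm, 'p, 'n) cat_functor" and \<tau> :: "'o \<Rightarrow> 'n" +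
  assumes component_iso: "a \<in> Obj C \<Longrightarrow> is_iso D (\<tau> a)"

locale adjunction =
  F: is_functor C D F + G: is_functor D C G +
  unit: natural_transformation C C id_functor "G \<circ>\<^sub>F F" \<eta> +
  counit: natural_transformation D D "F \<circ>\<^sub>F G" id_functor \<epsilon>
  for C :: "('o, 'm, 'x) category_scheme" and D :: "('p, 'n, 'y) category_scheme"
    and F :: "('o, 'm, 'p, 'n) cat_functor" and G :: "('p, 'n, 'o, 'm) cat_functor"
    and \<eta> :: "'o \<Rightarrow> 'm" and \<epsilon> :: "'p \<Rightarrow> 'n" +
  assumes triangle_left: "a \<in> Obj C \<Longrightarrow> \<epsilon> (FObj F a) \<cdot>\<^bsub>D\<^esub> FArr F (\<eta> a) = Ident D (FObj F a)"
    and triangle_right: "b \<in> Obj D \<Longrightarrow> FArr G (\<epsilon> b) \<cdot>\<^bsub>C\<^esub> \<eta> (FObj G b) = Ident C (FObj G b)"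

definition has_right_adjoint ::
  "('o, 'm, 'x) category_scheme \<Rightarrow> ('p, 'n, 'y) category_scheme \<Rightarrow>
   ('o, 'm, 'p, 'n) cat_functor \<Rightarrow> bool"
where
  "has_right_adjoint C D F \<longleftrightarrow> (\<exists>G \<eta> \<epsilon>. adjunction C D F G \<eta> \<epsilon>)"


section \<open>Closed symmetric monoidal categories\<close>

record ('o, 'm) monoidal_data = "('o, 'm) category" +
  Tensor :: "('o \<times> 'o, 'm \<times> 'm, 'o, 'm) cat_functor"
  Unit :: 'o ("\<one>\<index>")
  Assoc :: "'o \<times> 'o \<times> 'o \<Rightarrow> 'm"
  LUnit :: "'o \<Rightarrow> 'm"
  RUnit :: "'o \<Rightarrow> 'm"
  Braid :: "'o \<times> 'o \<Rightarrow> 'm"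

abbreviation tensor_obj :: "('o, 'm, 'x) monoidal_data_scheme \<Rightarrow> 'o \<Rightarrow> 'o \<Rightarrow> 'o"
  (infixl "\<otimes>\<index>" 70)
where "a \<otimes>\<^bsub>C\<^esub> b \<equiv> FObj (Tensor C) (a, b)"

abbreviation tensor_arr :: "('o, 'm, 'x) monoidal_data_scheme \<Rightarrow> 'm \<Rightarrow> 'm \<Rightarrow> 'm"
  (infixl "\<boxtimes>\<index>" 70)
where "f \<boxtimes>\<^bsub>C\<^esub> g \<equiv> FArr (Tensor C) (f, g)"

locale symmetric_monoidal_category = category C
  for C :: "('o, 'm, 'x) monoidal_data_scheme" (structure) +
  assumes Tensor_functor: "is_functor (prod_cat C C) C (Tensor C)"
    and Unit_in_Obj: "\<one> \<in> Obj C"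
    and Assoc_natural_iso:
      "natural_isomorphism (prod_cat C (prod_cat C C)) C
         \<lparr>FObj = (\<lambda>(a, b, c). (a \<otimes> b) \<otimes> c), FArr = (\<lambda>(f, g, h). (f \<boxtimes> g) \<boxtimes> h)\<rparr>
         \<lparr>FObj = (\<lambda>(a, b, c). a \<otimes> (b \<otimes> c)), FArr = (\<lambda>(f, g, h). f \<boxtimes> (g \<boxtimes> h))\<rparr>
         (Assoc C)"
    and LUnit_natural_iso:
      "natural_isomorphism C C
         \<lparr>FObj = (\<lambda>a. \<one> \<otimes> a), FArr = (\<lambda>f. Ident C \<one> \<boxtimes> f)\<rparr> id_functor (LUnit C)"
    and RUnit_natural_iso:
      "natural_isomorphism C C
         \<lparr>FObj = (\<lambda>a. a \<otimes> \<one>), FArr = (\<lambda>f. f \<boxtimes> Ident C \<one>)\<rparr> id_functor (RUnit C)"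
    and Braid_natural_iso:
      "natural_isomorphism (prod_cat C C) C
         (Tensor C)
         \<lparr>FObj = (\<lambda>(a, b). b \<otimes> a), FArr = (\<lambda>(f, g). g \<boxtimes> f)\<rparr>
         (Braid C)"
    and pentagon:
      "\<lbrakk>a \<in> Obj C; b \<in> Obj C; c \<in> Obj C; d \<in> Obj C\<rbrakk> \<Longrightarrow>
         Assoc C (a, b, c \<otimes> d) \<cdot> Assoc C (a \<otimes> b, c, d) =
         (Ident C a \<boxtimes> Assoc C (b, c, d)) \<cdot> Assoc C (a, b \<otimes> c, d) \<cdot> (Assoc C (a, b, c) \<boxtimes> Ident C d)"
    and triangle:
      "\<lbrakk>a \<in> Obj C; b \<in> Obj C\<rbrakk> \<Longrightarrow>
         (Ident C a \<boxtimes> LUnit C b) \<cdot> Assoc C (a, \<one>, b) = RUnit C a \<boxtimes> Ident C b"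
    and hexagon:
      "\<lbrakk>a \<in> Obj C; b \<in> Obj C; c \<in> Obj C\<rbrakk> \<Longrightarrow>
         Assoc C (b, c, a) \<cdot> Braid C (a, b \<otimes> c) \<cdot> Assoc C (a, b, c) =
         (Ident C b \<boxtimes> Braid C (a, c)) \<cdot> Assoc C (b, a, c) \<cdot> (Braid C (a, b) \<boxtimes> Ident C c)"
    and symmetry:
      "\<lbrakk>a \<in> Obj C; b \<in> Obj C\<rbrakk> \<Longrightarrow> Braid C (b, a) \<cdot> Braid C (a, b) = Ident C (a \<otimes> b)"

definition tensor_right ::
  "('o, 'm, 'x) monoidal_data_scheme \<Rightarrow> 'o \<Rightarrow> ('o, 'm, 'o, 'm) cat_functor"
where
  "tensor_right C a = \<lparr>FObj = (\<lambda>b. b \<otimes>\<^bsub>C\<^esub> a), FArr = (\<lambda>f. f \<boxtimes>\<^bsub>C\<^esub> Ident C a)\<rparr>"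

locale closed_symmetric_monoidal_category = symmetric_monoidal_category +
  assumes closed: "a \<in> Obj C \<Longrightarrow> has_right_adjoint C C (tensor_right C a)"


section \<open>Lax O(1)-volutive structures\<close>

text \<open>In the last axiom \<open>FArr d (\<eta> a)\<close> is an arrow from \<open>d (d (d a))\<close> to \<open>d a\<close> of \<open>C\<close>.\<close>

locale lax_O1_volutive_structure =
  d: is_functor C "op_cat C" d +
  \<eta>: natural_transformation C C id_functor "op_functor d \<circ>\<^sub>F d" \<eta>
  for C :: "('o, 'm, 'x) category_scheme" and d :: "('o, 'm, 'o, 'm) cat_functor"
    and \<eta> :: "'o \<Rightarrow> 'm" +
  assumes volutive_triangle:
    "a \<in> Obj C \<Longrightarrow> FArr d (\<eta> a) \<cdot>\<^bsub>C\<^esub> \<eta> (FObj d a) = Ident C (FObj d a)"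

end

(*
  Fix an object k and let d(a) be the internal hom from a to k, with evaluation
  ev_a : d(a) \<otimes> a \<rightarrow> k. The component \<eta>_a : a \<rightarrow> d(d(a)) is the transpose of
  ev_a \<circ> braid : a \<otimes> d(a) \<rightarrow> k. All equations are verified after transposing; the
  triangle identity then reduces to the braiding being its own inverse.
*)
theory Submission
  imports Defs
begin

section \<open>Hom-sets of opposite and product categories, and universality of the counit\<close>

lemma hom_op_cat [simp]: "hom (op_cat C) a b = hom C b a"
  by (auto simp: hom_def op_cat_def)

lemma op_cat_simps:
  "Obj (op_cat C) = Obj C"
  "Ident (op_cat C) = Ident C"
  "g \<cdot>\<^bsub>op_cat C\<^esub> f = f \<cdot>\<^bsub>C\<^esub> g"
  by (simp_all add: op_cat_def)

lemma hom_prod_cat: "hom (prod_cat C D) (a, a') (b, b') = hom C a b \<times> hom D a' b'"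
  by (auto simp: hom_def prod_cat_def)

lemma homD: "f \<in> hom C a b \<Longrightarrow> f \<in> Arr C \<and> Dom C f = a \<and> Cod C f = b"
  by (simp add: hom_def)

lemma (in category) hom_Obj:
  assumes "f \<in> hom C a b"
  shows "a \<in> Obj C" "b \<in> Obj C"
  using assms Dom_in_Obj Cod_in_Obj by (auto simp: hom_def)

lemma (in category) category_op: "category (op_cat C)"
proof
  fix f g h a b c d
  assume "f \<in> hom (op_cat C) a b" "g \<in> hom (op_cat C) b c" "h \<in> hom (op_cat C) c d"
  then show "(h \<cdot>\<^bsub>op_cat C\<^esub> g) \<cdot>\<^bsub>op_cat C\<^esub> f = h \<cdot>\<^bsub>op_cat C\<^esub> (g \<cdot>\<^bsub>op_cat C\<^esub> f)"
    \<comment> \<open>Associativity in the opposite category is associativity in \<open>C\<close>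
      read from right to left, so the three arrows and four objects enter in reverse order.\<close>
    using Comp_assoc[of h d c g b f a] by (simp add: op_cat_def hom_def)
qed (use Dom_in_Obj Cod_in_Obj Ident_in_hom Comp_in_hom Comp_Ident Ident_Comp in
      \<open>auto simp: op_cat_def hom_def\<close>)

text \<open>Existence is witnessed by the adjoint transpose \<open>G f\<close> after \<eta>, using
  naturality of \<epsilon> and the left triangle identity; uniqueness uses naturality of \<eta> and
  the right triangle identity. This form of adjointness is all that the duality below takes from
  closedness.\<close>

lemma (in adjunction) universal_counit:
  assumes a: "a \<in> Obj C" and b: "b \<in> Obj D" and f: "f \<in> hom D (FObj F a) b"
  shows "\<exists>!g. g \<in> hom C a (FObj G b) \<and> \<epsilon> b \<cdot>\<^bsub>D\<^esub> FArr F g = f"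
proof -
  have \<eta>: "\<eta> x \<in> hom C x (FObj G (FObj F x))" if "x \<in> Obj C" for x
    using unit.component_in_hom[OF that] by (simp add: comp_functor_def id_functor_def)
  have \<epsilon>: "\<epsilon> x \<in> hom D (FObj F (FObj G x)) x" if "x \<in> Obj D" for x
    using counit.component_in_hom[OF that] by (simp add: comp_functor_def id_functor_def)
  show ?thesis
  proof
    let ?g = "FArr G f \<cdot>\<^bsub>C\<^esub> \<eta> a"
    have Gf: "FArr G f \<in> hom C (FObj G (FObj F a)) (FObj G b)"
      using G.FArr_in_hom f by blast
    have "\<epsilon> b \<cdot>\<^bsub>D\<^esub> FArr F ?g = \<epsilon> b \<cdot>\<^bsub>D\<^esub> (FArr F (FArr G f) \<cdot>\<^bsub>D\<^esub> FArr F (\<eta> a))"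
      using F.FArr_Comp[OF \<eta>[OF a] Gf] by simp
    also have "\<dots> = (\<epsilon> b \<cdot>\<^bsub>D\<^esub> FArr F (FArr G f)) \<cdot>\<^bsub>D\<^esub> FArr F (\<eta> a)"
      using F.D.Comp_assoc[OF F.FArr_in_hom[OF \<eta>[OF a]] F.FArr_in_hom[OF Gf] \<epsilon>[OF b]] by simp
    also have "\<dots> = (f \<cdot>\<^bsub>D\<^esub> \<epsilon> (FObj F a)) \<cdot>\<^bsub>D\<^esub> FArr F (\<eta> a)"
      using counit.naturality[OF f] by (simp add: comp_functor_def id_functor_def)
    also have "\<dots> = f \<cdot>\<^bsub>D\<^esub> (\<epsilon> (FObj F a) \<cdot>\<^bsub>D\<^esub> FArr F (\<eta> a))"
      using F.D.Comp_assoc[OF F.FArr_in_hom[OF \<eta>[OF a]] \<epsilon>[OF F.FObj_in_Obj[OF a]] f] .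
    also have "\<dots> = f"
      using triangle_left[OF a] F.D.Comp_Ident[OF f] by simp
    finally show "?g \<in> hom C a (FObj G b) \<and> \<epsilon> b \<cdot>\<^bsub>D\<^esub> FArr F ?g = f"
      using F.C.Comp_in_hom[OF \<eta>[OF a] Gf] by simp
  next
    fix g
    assume "g \<in> hom C a (FObj G b) \<and> \<epsilon> b \<cdot>\<^bsub>D\<^esub> FArr F g = f"
    then have g: "g \<in> hom C a (FObj G b)" and eq: "\<epsilon> b \<cdot>\<^bsub>D\<^esub> FArr F g = f" by auto
    note Fg = F.FArr_in_hom[OF g]
    \<comment> \<open>Substitute for \<open>f\<close> its factorisation through
      \<open>\<epsilon> b\<close>; naturality of \<eta> then carries \<open>g\<close> out to the
      right, where the triangle identity leaves it alone.\<close>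
    have "FArr G f \<cdot>\<^bsub>C\<^esub> \<eta> a = (FArr G (\<epsilon> b) \<cdot>\<^bsub>C\<^esub> FArr G (FArr F g)) \<cdot>\<^bsub>C\<^esub> \<eta> a"
      using G.FArr_Comp[OF Fg \<epsilon>[OF b]] eq by simp
    also have "\<dots> = FArr G (\<epsilon> b) \<cdot>\<^bsub>C\<^esub> (FArr G (FArr F g) \<cdot>\<^bsub>C\<^esub> \<eta> a)"
      using F.C.Comp_assoc[OF \<eta>[OF a] G.FArr_in_hom[OF Fg] G.FArr_in_hom[OF \<epsilon>[OF b]]] .
    also have "\<dots> = FArr G (\<epsilon> b) \<cdot>\<^bsub>C\<^esub> (\<eta> (FObj G b) \<cdot>\<^bsub>C\<^esub> g)"
      using unit.naturality[OF g] by (simp add: comp_functor_def id_functor_def)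
    also have "\<dots> = (FArr G (\<epsilon> b) \<cdot>\<^bsub>C\<^esub> \<eta> (FObj G b)) \<cdot>\<^bsub>C\<^esub> g"
      using F.C.Comp_assoc[OF g \<eta>[OF G.FObj_in_Obj[OF b]] G.FArr_in_hom[OF \<epsilon>[OF b]]] by simp
    also have "\<dots> = g"
      using triangle_right[OF b] F.C.Ident_Comp[OF g] by simp
    finally show "g = FArr G f \<cdot>\<^bsub>C\<^esub> \<eta> a" ..
  qed
qed

section \<open>Bifunctoriality of the tensor product and naturality of the braiding\<close>

context symmetric_monoidal_category
begin

lemma tensor_Obj: "\<lbrakk>a \<in> Obj C; b \<in> Obj C\<rbrakk> \<Longrightarrow> a \<otimes> b \<in> Obj C"
  using is_functor.FObj_in_Obj[OF Tensor_functor, of "(a, b)"] by (simp add: prod_cat_def)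

lemma tensor_in_hom:
  "\<lbrakk>f \<in> hom C a a'; g \<in> hom C b b'\<rbrakk> \<Longrightarrow> f \<boxtimes> g \<in> hom C (a \<otimes> b) (a' \<otimes> b')"
  using is_functor.FArr_in_hom[OF Tensor_functor, of "(f, g)" "(a, b)" "(a', b')"]
  by (simp add: hom_prod_cat)

lemma tensor_Ident: "\<lbrakk>a \<in> Obj C; b \<in> Obj C\<rbrakk> \<Longrightarrow> Ident C a \<boxtimes> Ident C b = Ident C (a \<otimes> b)"
  using is_functor.FArr_Ident[OF Tensor_functor, of "(a, b)"] by (simp add: prod_cat_def)

lemma tensor_Comp:
  assumes "f \<in> hom C a b" "g \<in> hom C b c" "f' \<in> hom C a' b'" "g' \<in> hom C b' c'"
  shows "(g \<cdot> f) \<boxtimes> (g' \<cdot> f') = (g \<boxtimes> g') \<cdot> (f \<boxtimes> f')"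
  using is_functor.FArr_Comp[OF Tensor_functor,
      of "(f, f')" "(a, a')" "(b, b')" "(g, g')" "(c, c')"] assms
  \<comment> \<open>The premises must be split by \<open>hom_prod_cat\<close> before
    \<open>prod_cat_def\<close> destroys its left-hand side, hence two separate calls.\<close>
  by (simp add: hom_prod_cat) (simp add: prod_cat_def)

text \<open>By bifunctoriality both composites are equal to \<open>f \<boxtimes> g\<close>.\<close>

lemma tensor_interchange:
  assumes f: "f \<in> hom C a a'" and g: "g \<in> hom C b b'"
  shows "(f \<boxtimes> Ident C b') \<cdot> (Ident C a \<boxtimes> g) = (Ident C a' \<boxtimes> g) \<cdot> (f \<boxtimes> Ident C b)"
proof -
  note I = Ident_in_hom[OF hom_Obj(1)[OF f]] Ident_in_hom[OF hom_Obj(2)[OF f]]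
    Ident_in_hom[OF hom_Obj(1)[OF g]] Ident_in_hom[OF hom_Obj(2)[OF g]]
  show ?thesis
    using tensor_Comp[OF I(1) f g I(4)] tensor_Comp[OF f I(2) I(3) g]
      Comp_Ident[OF f] Ident_Comp[OF f] Comp_Ident[OF g] Ident_Comp[OF g] by simp
qed

lemma tensor_Comp_right:
  assumes f: "f \<in> hom C a b" and g: "g \<in> hom C b c" and x: "x \<in> Obj C"
  shows "(g \<cdot> f) \<boxtimes> Ident C x = (g \<boxtimes> Ident C x) \<cdot> (f \<boxtimes> Ident C x)"
  using tensor_Comp[OF f g Ident_in_hom[OF x] Ident_in_hom[OF x]]
    Comp_Ident[OF Ident_in_hom[OF x]] by simp

lemma tensor_Comp_left:
  assumes f: "f \<in> hom C a b" and g: "g \<in> hom C b c" and x: "x \<in> Obj C"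
  shows "Ident C x \<boxtimes> (g \<cdot> f) = (Ident C x \<boxtimes> g) \<cdot> (Ident C x \<boxtimes> f)"
  using tensor_Comp[OF Ident_in_hom[OF x] Ident_in_hom[OF x] f g]
    Comp_Ident[OF Ident_in_hom[OF x]] by simp

lemma braid_in_hom: "\<lbrakk>a \<in> Obj C; b \<in> Obj C\<rbrakk> \<Longrightarrow> Braid C (a, b) \<in> hom C (a \<otimes> b) (b \<otimes> a)"
  using natural_transformation.component_in_hom
      [OF natural_isomorphism.axioms(1)[OF Braid_natural_iso], of "(a, b)"]
  by (simp add: prod_cat_def)

lemma braid_natural:
  assumes "f \<in> hom C a a'" "g \<in> hom C b b'"
  shows "Braid C (a', b') \<cdot> (f \<boxtimes> g) = (g \<boxtimes> f) \<cdot> Braid C (a, b)"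
  using natural_transformation.naturality
      [OF natural_isomorphism.axioms(1)[OF Braid_natural_iso],
        of "(f, g)" "(a, b)" "(a', b')"] assms
  by (simp add: hom_prod_cat)

end

section \<open>Duality into a fixed object, described by universal evaluations\<close>

locale dual_pairing = symmetric_monoidal_category +
  fixes k :: 'a and dual :: "'a \<Rightarrow> 'a" and ev :: "'a \<Rightarrow> 'b"
  assumes dual_Obj: "a \<in> Obj C \<Longrightarrow> dual a \<in> Obj C"
    and ev_in_hom: "a \<in> Obj C \<Longrightarrow> ev a \<in> hom C (dual a \<otimes> a) k"
    and ev_universal: "\<lbrakk>a \<in> Obj C; b \<in> Obj C; f \<in> hom C (b \<otimes> a) k\<rbrakk> \<Longrightarrow>
      \<exists>!g. g \<in> hom C b (dual a) \<and> ev a \<cdot> (g \<boxtimes> Ident C a) = f"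
begin

definition transpose :: "'a \<Rightarrow> 'a \<Rightarrow> 'b \<Rightarrow> 'b" where
  "transpose a b f = (THE g. g \<in> hom C b (dual a) \<and> ev a \<cdot> (g \<boxtimes> Ident C a) = f)"

lemma transpose:
  assumes "a \<in> Obj C" "b \<in> Obj C" "f \<in> hom C (b \<otimes> a) k"
  shows transpose_in_hom: "transpose a b f \<in> hom C b (dual a)"
    and ev_transpose: "ev a \<cdot> (transpose a b f \<boxtimes> Ident C a) = f"
  using theI'[OF ev_universal[OF assms]] by (simp_all add: transpose_def)

text \<open>The uniqueness half of \<open>ev_universal\<close>. It reduces every equation between
  arrows into a dual to an equation between arrows into \<open>k\<close>, and all later identities
  are proved through it.\<close>

lemma ev_cancel:
  assumes a: "a \<in> Obj C" and g: "g \<in> hom C b (dual a)" and h: "h \<in> hom C b (dual a)"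
    and eq: "ev a \<cdot> (g \<boxtimes> Ident C a) = ev a \<cdot> (h \<boxtimes> Ident C a)"
  shows "g = h"
proof -
  have "ev a \<cdot> (h \<boxtimes> Ident C a) \<in> hom C (b \<otimes> a) k"
    using Comp_in_hom[OF tensor_in_hom[OF h Ident_in_hom[OF a]] ev_in_hom[OF a]] .
  from ev_universal[OF a hom_Obj(1)[OF h] this] show ?thesis
    using g h eq by blast
qed

text \<open>The arrow map of a functor receives only the arrow, so source and target are recovered
  through \<open>Dom\<close> and \<open>Cod\<close>.\<close>

definition dual_arr :: "'b \<Rightarrow> 'b" where
  "dual_arr f = transpose (Dom C f) (dual (Cod C f))
     (ev (Cod C f) \<cdot> (Ident C (dual (Cod C f)) \<boxtimes> f))"

definition double_dual :: "'a \<Rightarrow> 'b" where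
  "double_dual a = transpose (dual a) a (ev a \<cdot> Braid C (a, dual a))"

text \<open>The second claim is dinaturality of evaluation: an arrow acting on the object slot can
  be moved to the dual slot. By \<open>ev_cancel\<close> it characterises \<open>dual_arr f\<close>,
  and with the typing it replaces the definition from here on.\<close>

lemma dual_arr:
  assumes f: "f \<in> hom C a b"
  shows dual_arr_in_hom: "dual_arr f \<in> hom C (dual b) (dual a)"
    and ev_dual_arr: "ev a \<cdot> (dual_arr f \<boxtimes> Ident C a) = ev b \<cdot> (Ident C (dual b) \<boxtimes> f)"
proof -
  note ab = hom_Obj[OF f]
  have "ev b \<cdot> (Ident C (dual b) \<boxtimes> f) \<in> hom C (dual b \<otimes> a) k"
    using Comp_in_hom[OF tensor_in_hom[OF Ident_in_hom[OF dual_Obj[OF ab(2)]] f] ev_in_hom[OF ab(2)]] .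
  from transpose[OF ab(1) dual_Obj[OF ab(2)] this]
  show "dual_arr f \<in> hom C (dual b) (dual a)"
    and "ev a \<cdot> (dual_arr f \<boxtimes> Ident C a) = ev b \<cdot> (Ident C (dual b) \<boxtimes> f)"
    using homD[OF f] by (simp_all add: dual_arr_def)
qed

lemma double_dual:
  assumes a: "a \<in> Obj C"
  shows double_dual_in_hom: "double_dual a \<in> hom C a (dual (dual a))"
    and ev_double_dual:
      "ev (dual a) \<cdot> (double_dual a \<boxtimes> Ident C (dual a)) = ev a \<cdot> Braid C (a, dual a)"
proof -
  have "ev a \<cdot> Braid C (a, dual a) \<in> hom C (a \<otimes> dual a) k"
    using Comp_in_hom[OF braid_in_hom[OF a dual_Obj[OF a]] ev_in_hom[OF a]] .
  from transpose[OF dual_Obj[OF a] a this]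
  show "double_dual a \<in> hom C a (dual (dual a))"
    and "ev (dual a) \<cdot> (double_dual a \<boxtimes> Ident C (dual a)) = ev a \<cdot> Braid C (a, dual a)"
    by (simp_all add: double_dual_def)
qed

text \<open>Dinaturality moves \<open>f\<close> into the second slot, where it commutes with
  \<open>g\<close> acting on the first. It serves with \<open>g\<close> a dual arrow for
  functoriality, and with \<open>g\<close> a double dual map for naturality and the
  triangle.\<close>

lemma ev_dual_arr_Comp:
  assumes f: "f \<in> hom C a b" and g: "g \<in> hom C c (dual b)"
  shows "ev a \<cdot> ((dual_arr f \<cdot> g) \<boxtimes> Ident C a) = ev b \<cdot> (g \<boxtimes> Ident C b) \<cdot> (Ident C c \<boxtimes> f)"
proof -
  note ab = hom_Obj[OF f] and df = dual_arr_in_hom[OF f]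
  note Ia = Ident_in_hom[OF ab(1)] and Ib = Ident_in_hom[OF ab(2)]
    and Ic = Ident_in_hom[OF hom_Obj(1)[OF g]] and Idb = Ident_in_hom[OF dual_Obj[OF ab(2)]]
  have "ev a \<cdot> ((dual_arr f \<cdot> g) \<boxtimes> Ident C a)
      = ev a \<cdot> (dual_arr f \<boxtimes> Ident C a) \<cdot> (g \<boxtimes> Ident C a)"
    using tensor_Comp_right[OF g df ab(1)] by simp
  also have "\<dots> = (ev a \<cdot> (dual_arr f \<boxtimes> Ident C a)) \<cdot> (g \<boxtimes> Ident C a)"
    using Comp_assoc[OF tensor_in_hom[OF g Ia] tensor_in_hom[OF df Ia] ev_in_hom[OF ab(1)]] by simp
  also have "\<dots> = (ev b \<cdot> (Ident C (dual b) \<boxtimes> f)) \<cdot> (g \<boxtimes> Ident C a)"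
    using ev_dual_arr[OF f] by simp
  also have "\<dots> = ev b \<cdot> (Ident C (dual b) \<boxtimes> f) \<cdot> (g \<boxtimes> Ident C a)"
    using Comp_assoc[OF tensor_in_hom[OF g Ia] tensor_in_hom[OF Idb f] ev_in_hom[OF ab(2)]] .
  also have "\<dots> = ev b \<cdot> (g \<boxtimes> Ident C b) \<cdot> (Ident C c \<boxtimes> f)"
    using tensor_interchange[OF g f] by simp
  finally show ?thesis .
qed

text \<open>Evaluating against \<open>double_dual a\<close> is evaluation at \<open>a\<close> after
  a swap, and naturality of the braiding pulls the swap in front of both arrows. In each use below
  one of \<open>f\<close> and \<open>g\<close> is an identity.\<close>

lemma ev_double_dual_Comp:
  assumes f: "f \<in> hom C c a" and g: "g \<in> hom C b (dual a)"
  shows "(ev (dual a) \<cdot> (double_dual a \<boxtimes> Ident C (dual a))) \<cdot> (f \<boxtimes> g)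
    = ev a \<cdot> (g \<boxtimes> f) \<cdot> Braid C (c, b)"
proof -
  have a: "a \<in> Obj C" using hom_Obj[OF f] by simp
  have "(ev (dual a) \<cdot> (double_dual a \<boxtimes> Ident C (dual a))) \<cdot> (f \<boxtimes> g)
      = (ev a \<cdot> Braid C (a, dual a)) \<cdot> (f \<boxtimes> g)"
    using ev_double_dual[OF a] by simp
  also have "\<dots> = ev a \<cdot> Braid C (a, dual a) \<cdot> (f \<boxtimes> g)"
    using Comp_assoc[OF tensor_in_hom[OF f g] braid_in_hom[OF a dual_Obj[OF a]] ev_in_hom[OF a]] .
  also have "\<dots> = ev a \<cdot> (g \<boxtimes> f) \<cdot> Braid C (c, b)"
    using braid_natural[OF f g] by simp
  finally show ?thesis .
qed

lemma dual_arr_Ident: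
  assumes a: "a \<in> Obj C"
  shows "dual_arr (Ident C a) = Ident C (dual a)"
  using ev_cancel[OF a dual_arr_in_hom[OF Ident_in_hom[OF a]] Ident_in_hom[OF dual_Obj[OF a]]]
    ev_dual_arr[OF Ident_in_hom[OF a]] by simp

text \<open>Dinaturality, applied once for each arrow, brings both into the second slot of
  \<open>ev c\<close>; there they compose in their original order, which makes the dual
  contravariant.\<close>

lemma dual_arr_Comp:
  assumes f: "f \<in> hom C a b" and g: "g \<in> hom C b c"
  shows "dual_arr (g \<cdot> f) = dual_arr f \<cdot> dual_arr g"
proof (rule ev_cancel)
  note gf = Comp_in_hom[OF f g]
  note a = hom_Obj(1)[OF f] and b = hom_Obj(2)[OF f] and c = hom_Obj(2)[OF g]
  note Idc = Ident_in_hom[OF dual_Obj[OF c]]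
  show "a \<in> Obj C" by (rule a)
  show "dual_arr (g \<cdot> f) \<in> hom C (dual c) (dual a)" by (rule dual_arr_in_hom[OF gf])
  show "dual_arr f \<cdot> dual_arr g \<in> hom C (dual c) (dual a)"
    by (rule Comp_in_hom[OF dual_arr_in_hom[OF g] dual_arr_in_hom[OF f]])
  have "ev a \<cdot> ((dual_arr f \<cdot> dual_arr g) \<boxtimes> Ident C a)
      = ev b \<cdot> (dual_arr g \<boxtimes> Ident C b) \<cdot> (Ident C (dual c) \<boxtimes> f)"
    by (rule ev_dual_arr_Comp[OF f dual_arr_in_hom[OF g]])
  also have "\<dots> = (ev b \<cdot> (dual_arr g \<boxtimes> Ident C b)) \<cdot> (Ident C (dual c) \<boxtimes> f)"
    using Comp_assoc[OF tensor_in_hom[OF Idc f]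
        tensor_in_hom[OF dual_arr_in_hom[OF g] Ident_in_hom[OF b]] ev_in_hom[OF b]] by simp
  also have "\<dots> = (ev c \<cdot> (Ident C (dual c) \<boxtimes> g)) \<cdot> (Ident C (dual c) \<boxtimes> f)"
    using ev_dual_arr[OF g] by simp
  also have "\<dots> = ev c \<cdot> (Ident C (dual c) \<boxtimes> g) \<cdot> (Ident C (dual c) \<boxtimes> f)"
    by (rule Comp_assoc[OF tensor_in_hom[OF Idc f] tensor_in_hom[OF Idc g] ev_in_hom[OF c]])
  also have "\<dots> = ev c \<cdot> (Ident C (dual c) \<boxtimes> (g \<cdot> f))"
    using tensor_Comp_left[OF f g dual_Obj[OF c]] by simp
  finally show "ev a \<cdot> (dual_arr (g \<cdot> f) \<boxtimes> Ident C a)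
      = ev a \<cdot> ((dual_arr f \<cdot> dual_arr g) \<boxtimes> Ident C a)"
    using ev_dual_arr[OF gf] by simp
qed

text \<open>Evaluated at \<open>dual b\<close>, both sides become a swap followed by the pairing of
  \<open>dual b\<close> with \<open>a\<close> into \<open>k\<close> that \<open>f\<close> induces.
  This pairing has two expressions, one through \<open>ev b\<close> and one through
  \<open>ev a\<close>, which agree by dinaturality.\<close>

lemma double_dual_natural:
  assumes f: "f \<in> hom C a b"
  shows "double_dual b \<cdot> f = dual_arr (dual_arr f) \<cdot> double_dual a"
proof (rule ev_cancel)
  note a = hom_Obj(1)[OF f] and b = hom_Obj(2)[OF f] and df = dual_arr_in_hom[OF f]
  note da = dual_Obj[OF a] and db = dual_Obj[OF b]
  note ha = double_dual_in_hom[OF a] and hb = double_dual_in_hom[OF b]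
  note Ia = Ident_in_hom[OF a] and Ida = Ident_in_hom[OF da] and Idb = Ident_in_hom[OF db]
  show "dual b \<in> Obj C" by (rule db)
  show "double_dual b \<cdot> f \<in> hom C a (dual (dual b))" by (rule Comp_in_hom[OF f hb])
  show "dual_arr (dual_arr f) \<cdot> double_dual a \<in> hom C a (dual (dual b))"
    by (rule Comp_in_hom[OF ha dual_arr_in_hom[OF df]])
  have "ev (dual b) \<cdot> ((double_dual b \<cdot> f) \<boxtimes> Ident C (dual b))
      = (ev (dual b) \<cdot> (double_dual b \<boxtimes> Ident C (dual b))) \<cdot> (f \<boxtimes> Ident C (dual b))"
    using tensor_Comp_right[OF f hb db]
      Comp_assoc[OF tensor_in_hom[OF f Idb] tensor_in_hom[OF hb Idb] ev_in_hom[OF db]] by simp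
  also have "\<dots> = ev b \<cdot> (Ident C (dual b) \<boxtimes> f) \<cdot> Braid C (a, dual b)"
    by (rule ev_double_dual_Comp[OF f Idb])
  also have "\<dots> = (ev b \<cdot> (Ident C (dual b) \<boxtimes> f)) \<cdot> Braid C (a, dual b)"
    using Comp_assoc[OF braid_in_hom[OF a db] tensor_in_hom[OF Idb f] ev_in_hom[OF b]] by simp
  \<comment> \<open>The passage from \<open>b\<close> to \<open>a\<close>; what follows runs the
    first half backwards with \<open>dual_arr f\<close> in place of \<open>f\<close>.\<close>
  also have "\<dots> = (ev a \<cdot> (dual_arr f \<boxtimes> Ident C a)) \<cdot> Braid C (a, dual b)"
    using ev_dual_arr[OF f] by simp
  also have "\<dots> = ev a \<cdot> (dual_arr f \<boxtimes> Ident C a) \<cdot> Braid C (a, dual b)"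
    by (rule Comp_assoc[OF braid_in_hom[OF a db] tensor_in_hom[OF df Ia] ev_in_hom[OF a]])
  also have "\<dots> = (ev (dual a) \<cdot> (double_dual a \<boxtimes> Ident C (dual a))) \<cdot> (Ident C a \<boxtimes> dual_arr f)"
    using ev_double_dual_Comp[OF Ia df] by simp
  also have "\<dots> = ev (dual a) \<cdot> (double_dual a \<boxtimes> Ident C (dual a)) \<cdot> (Ident C a \<boxtimes> dual_arr f)"
    by (rule Comp_assoc[OF tensor_in_hom[OF Ia df] tensor_in_hom[OF ha Ida] ev_in_hom[OF da]])
  also have "\<dots> = ev (dual b) \<cdot> ((dual_arr (dual_arr f) \<cdot> double_dual a) \<boxtimes> Ident C (dual b))"
    using ev_dual_arr_Comp[OF df ha] by simp
  finally show "ev (dual b) \<cdot> ((double_dual b \<cdot> f) \<boxtimes> Ident C (dual b))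
      = ev (dual b) \<cdot> ((dual_arr (dual_arr f) \<cdot> double_dual a) \<boxtimes> Ident C (dual b))" .
qed

text \<open>Each of the two double dual maps contributes one braiding under evaluation. These are
  mutually inverse by \<open>symmetry\<close>, so only \<open>ev a\<close> survives, which is also
  the evaluation of the identity.\<close>

lemma double_dual_triangle:
  assumes a: "a \<in> Obj C"
  shows "dual_arr (double_dual a) \<cdot> double_dual (dual a) = Ident C (dual a)"
proof (rule ev_cancel[OF a])
  note da = dual_Obj[OF a] and ha = double_dual_in_hom[OF a]
  note dda = dual_Obj[OF da] and hda = double_dual_in_hom[OF da]
  note Ia = Ident_in_hom[OF a] and Ida = Ident_in_hom[OF da] and Idda = Ident_in_hom[OF dda]
  show "dual_arr (double_dual a) \<cdot> double_dual (dual a) \<in> hom C (dual a) (dual a)"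
    by (rule Comp_in_hom[OF hda dual_arr_in_hom[OF ha]])
  show "Ident C (dual a) \<in> hom C (dual a) (dual a)" by (rule Ida)
  have "ev a \<cdot> ((dual_arr (double_dual a) \<cdot> double_dual (dual a)) \<boxtimes> Ident C a)
      = ev (dual (dual a)) \<cdot> (double_dual (dual a) \<boxtimes> Ident C (dual (dual a)))
          \<cdot> (Ident C (dual a) \<boxtimes> double_dual a)"
    by (rule ev_dual_arr_Comp[OF ha hda])
  also have "\<dots> = (ev (dual (dual a)) \<cdot> (double_dual (dual a) \<boxtimes> Ident C (dual (dual a))))
          \<cdot> (Ident C (dual a) \<boxtimes> double_dual a)"
    using Comp_assoc[OF tensor_in_hom[OF Ida ha] tensor_in_hom[OF hda Idda] ev_in_hom[OF dda]] by simp
  \<comment> \<open>The rule is taken at the object \<open>dual a\<close>. The swap carries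
    \<open>double_dual a\<close> from the second slot to the first, where
    \<open>ev_double_dual\<close> can act on it.\<close>
  also have "\<dots> = ev (dual a) \<cdot> (double_dual a \<boxtimes> Ident C (dual a)) \<cdot> Braid C (dual a, a)"
    by (rule ev_double_dual_Comp[OF Ida ha])
  also have "\<dots> = (ev (dual a) \<cdot> (double_dual a \<boxtimes> Ident C (dual a))) \<cdot> Braid C (dual a, a)"
    using Comp_assoc[OF braid_in_hom[OF da a] tensor_in_hom[OF ha Ida] ev_in_hom[OF da]] by simp
  also have "\<dots> = (ev a \<cdot> Braid C (a, dual a)) \<cdot> Braid C (dual a, a)"
    using ev_double_dual[OF a] by simp
  also have "\<dots> = ev a \<cdot> Braid C (a, dual a) \<cdot> Braid C (dual a, a)"
    by (rule Comp_assoc[OF braid_in_hom[OF da a] braid_in_hom[OF a da] ev_in_hom[OF a]])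
  \<comment> \<open>The identity of the tensor product is split into two identities to match the
    shape required by \<open>ev_cancel\<close>.\<close>
  also have "\<dots> = ev a \<cdot> (Ident C (dual a) \<boxtimes> Ident C a)"
    using symmetry[OF da a] tensor_Ident[OF da a] by simp
  finally show "ev a \<cdot> ((dual_arr (double_dual a) \<cdot> double_dual (dual a)) \<boxtimes> Ident C a)
      = ev a \<cdot> (Ident C (dual a) \<boxtimes> Ident C a)" .
qed

lemma lax_O1_volutive_structure_dual:
  "lax_O1_volutive_structure C \<lparr>FObj = dual, FArr = dual_arr\<rparr> double_dual"
proof -
  interpret op: category "op_cat C" by (rule category_op)
  show ?thesis
    \<comment> \<open>The target of the natural transformation must itself be shown to be a functor;
      the instance of \<open>dual_arr_Comp\<close> at dual arrows gives its compatibility with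
      composition.\<close>
    by unfold_locales
      (auto simp: id_functor_def comp_functor_def op_functor_def op_cat_simps dual_Obj
        dual_arr_Ident dual_arr_Comp dual_arr_Comp[OF dual_arr_in_hom dual_arr_in_hom]
        double_dual_in_hom double_dual_natural double_dual_triangle intro: dual_arr_in_hom)
qed

end

section \<open>Evaluations obtained from closedness, and the conclusion\<close>

lemma (in closed_symmetric_monoidal_category) dual_pairing_exists:
  assumes k: "k \<in> Obj C"
  shows "\<exists>dual ev. dual_pairing C k dual ev"
proof -
  have "\<exists>G \<eta> \<epsilon>. adjunction C C (tensor_right C a) G \<eta> \<epsilon>" if "a \<in> Obj C" for a
    using closed[OF that] by (simp add: has_right_adjoint_def)
  \<comment> \<open>One adjunction is chosen independently for each object \<open>a\<close>. No
    coherence between the choices is required, since \<open>dual_pairing\<close> asks only for a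
    pointwise universal property.\<close>
  then obtain G \<eta> \<epsilon> where adj: "adjunction C C (tensor_right C a) (G a) (\<eta> a) (\<epsilon> a)"
    if "a \<in> Obj C" for a
    by metis
  \<comment> \<open>The dual of \<open>a\<close> is the internal hom from \<open>a\<close> to
    \<open>k\<close>, and its evaluation is the counit at \<open>k\<close>;
    \<open>universal_counit\<close> for \<open>tensor_right C a\<close> becomes
    \<open>ev_universal\<close>.\<close>
  have "dual_pairing C k (\<lambda>a. FObj (G a) k) (\<lambda>a. \<epsilon> a k)"
  proof
    fix a assume a: "a \<in> Obj C"
    interpret adjunction C C "tensor_right C a" "G a" "\<eta> a" "\<epsilon> a" by (rule adj[OF a])
    show "FObj (G a) k \<in> Obj C" using G.FObj_in_Obj[OF k] .
    show "\<epsilon> a k \<in> hom C (FObj (G a) k \<otimes> a) k"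
      using counit.component_in_hom[OF k]
      by (simp add: comp_functor_def id_functor_def tensor_right_def)
    fix b f assume "b \<in> Obj C" "f \<in> hom C (b \<otimes> a) k"
    then show "\<exists>!g. g \<in> hom C b (FObj (G a) k) \<and> \<epsilon> a k \<cdot> (g \<boxtimes> Ident C a) = f"
      using universal_counit[of b k f] k by (simp add: tensor_right_def)
  qed
  then show ?thesis by blast
qed

theorem theorem1:
  fixes C :: "('o, 'm, 'x) monoidal_data_scheme"
  assumes "closed_symmetric_monoidal_category C"
  shows "\<exists>d \<eta>. lax_O1_volutive_structure C d \<eta>"
proof -
  interpret closed_symmetric_monoidal_category C by (rule assms)
  \<comment> \<open>Any object could serve as the dualising target; the monoidal unit is one that is
    always at hand.\<close>
  obtain dual ev where "dual_pairing C (Unit C) dual ev"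
    using dual_pairing_exists[OF Unit_in_Obj] by blast
  from dual_pairing.lax_O1_volutive_structure_dual[OF this] show ?thesis
    by (intro exI)
qed

end
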